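(* Let $x,y,z,w\in R=\mathbb{C}[s,t,u]$ be homogeneous polynomials of degree $n$ such that the rational map $(s:t:u)\mapsto (x:y:z:w)$ from $\mathbb{P}^2$ to $\mathbb{P}^3$ parametrizes a surface, and let $I=\langle x,y,z,w\rangle$. If $I$ is saturated and the base point conditions BP1--BP5 hold for $d\in\{n-2,n-1\}$, then $d=n-2$ and $n\le3$. (That is, in the saturated case the method of moving quadrics in degree $d$ works only for $d=n-2$ and $n\leq 3$.)
   Context: $R=\mathbb{C}[s,t,u]$ has its standard grading. $V(I)\subset\mathbb{P}^2$ is the subscheme defined by $I$; when it is finite, $\deg(V(I))=\dim_{\mathbb{C}}(R/I)_k$ for $k\gg0$. The multiplicity of $p\in V(I)$ is the Hilbert--Samuel multiplicity of the ideal induced by $I$ in $\mathcal{O}_{\mathbb{P}^2,p}$. For a homogeneous ideal $J$, $\mathrm{sat}(J)$ is its saturation with respect to $\langle s,t,u\rangle$, and $I$ saturated means $I=\mathrm{sat}(I)$. $\mathrm{Syz}(x,y,z)_d$ is the $\mathbb{C}$-vector space of triples $(a,b,c)\in R_d^3$ with $ax+by+cz=0$. "Parametrizes a surface" means that the Zariski closure of the image is two-dimensional. Base point conditions: BP1: $x,y,z,w$ are homogeneous of degree $n$ and linearly independent over $\mathbb{C}$. BP2: $V(I)$ consists of a finite number of points and $\deg(V(I))$ equals the sum of the multiplicities of the distinct points of $V(I)$ (equivalently, $V(I)$ is a local complete intersection). BP3: there is $d\in\{n-2,n-1\}$ such that $\dim_{\mathbb{C}}(R/I)_{d+n}=\deg(V(I))$.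 BP4: $w\in\mathrm{sat}(\langle x,y,z\rangle)$. BP5: $\dim\mathrm{Syz}(x,y,z)_d=0$, where $d$ is as in BP3. The method of moving quadrics in degree $d$ consists in forming, under these conditions, a square matrix of size $\binom{d+2}{2}$ whose rows are the coefficients (with respect to the degree $d$ monomials in $s,t,u$) of a basis of the $m=\dim\mathrm{Syz}(x,y,z,w)_d$ linearly independent moving planes of degree $d$ (syzygies of $x,y,z,w$ viewed as linear forms in $X,Y,Z,W$) together with $\binom{d+2}{2}-m$ linearly independent moving quadrics of degree $d$ (quadratic forms in $X,Y,Z,W$ over $R_d$ vanishing at $(x,y,z,w)$), whose determinant is the implicit equation; it requires $\binom{d+2}{2}-m\ge0$. *)

theory Defs
  imports
    "HOL-Analysis.Analysis"
    "HOL-Library.Poly_Mapping"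
    "HOL-Computational_Algebra.Fraction_Field"
    "HOL-Algebra.Ideal_Product"
begin

section \<open>Complex polynomials in finitely many variables\<close>

text \<open>A polynomial maps exponent vectors to coefficients. The variables are indexed by a
  finite type: \<open>3 mpoly\<close> is \<open>\<complex>[s,t,u]\<close> and \<open>4 mpoly\<close> is
  \<open>\<complex>[X,Y,Z,W]\<close>.\<close>

type_synonym 'v mpoly = "('v \<Rightarrow>\<^sub>0 nat) \<Rightarrow>\<^sub>0 complex"

definition var :: "'v \<Rightarrow> 'v mpoly" where
  "var i = Poly_Mapping.single (Poly_Mapping.single i 1) 1"

definition cscale :: "complex \<Rightarrow> 'v mpoly \<Rightarrow> 'v mpoly" where
  "cscale c f = Poly_Mapping.single 0 c * f"

definition eval_mpoly :: "'v::finite mpoly \<Rightarrow> complex ^ 'v \<Rightarrow> complex" where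
  "eval_mpoly f v =
     (\<Sum>m\<in>Poly_Mapping.keys f. Poly_Mapping.lookup f m * (\<Prod>i\<in>UNIV. (v $ i) ^ Poly_Mapping.lookup m i))"

text \<open>The zero polynomial is homogeneous of every degree.\<close>

definition homogeneous :: "nat \<Rightarrow> 'v::finite mpoly \<Rightarrow> bool" where
  "homogeneous k f \<longleftrightarrow> (\<forall>m\<in>Poly_Mapping.keys f. (\<Sum>i\<in>UNIV. Poly_Mapping.lookup m i) = k)"

abbreviation graded_piece :: "nat \<Rightarrow> 'v::finite mpoly set" where
  "graded_piece k \<equiv> {f. homogeneous k f}"

text \<open>\<open>quotient_dim V W\<close> is the dimension of the image of \<open>V\<close> in the quotient of the whole
  space by \<open>W\<close>, that is of \<open>V / (V \<inter> W)\<close> when both are subspaces: \<open>B\<close> is a set of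
  representatives of a basis. It is only meaningful when this dimension is finite.\<close>

definition (in vector_space) quotient_dim :: "'b set \<Rightarrow> 'b set \<Rightarrow> nat" where
  "quotient_dim V W = (THE N. \<exists>B. B \<subseteq> V \<and> finite B \<and> card B = N \<and>
     (\<forall>a. (\<Sum>b\<in>B. scale (a b) b) \<in> W \<longrightarrow> (\<forall>b\<in>B. a b = 0)) \<and>
     (\<forall>v\<in>V. \<exists>a. v - (\<Sum>b\<in>B. scale (a b) b) \<in> W))"

interpretation mpoly: vector_space cscale
  by unfold_locales
    (simp_all add: cscale_def algebra_simps single_add mult_single flip: mult.assoc)

definition cscale3 :: "complex \<Rightarrow> 'v mpoly \<times> 'v mpoly \<times> 'v mpoly \<Rightarrow> 'v mpoly \<times> 'v mpoly \<times> 'v mpoly"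
  where "cscale3 k = (\<lambda>(a, b, c). (cscale k a, cscale k b, cscale k c))"

interpretation mpoly3: vector_space cscale3
  by unfold_locales
    (auto simp: cscale3_def mpoly.scale_right_distrib mpoly.scale_left_distrib)


section \<open>Ideals, saturation, syzygies\<close>

abbreviation ideal_gen :: "'a::comm_ring_1 set \<Rightarrow> 'a set" where
  "ideal_gen \<equiv> module.span (*)"

lemma module_times: "module ((*) :: 'a::comm_ring_1 \<Rightarrow> 'a \<Rightarrow> 'a)"
  by unfold_locales (simp_all add: algebra_simps)

definition ideal_power :: "'a::comm_ring_1 set \<Rightarrow> nat \<Rightarrow> 'a set" where
  "ideal_power J k = ideal_gen {prod_list fs | fs. length fs = k \<and> set fs \<subseteq> J}"

definition saturation :: "'v mpoly set \<Rightarrow> 'v mpoly set" where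
  "saturation J = {f. \<exists>k. \<forall>g\<in>ideal_power (ideal_gen (range var)) k. f * g \<in> J}"

definition Syz :: "'v::finite mpoly \<Rightarrow> 'v mpoly \<Rightarrow> 'v mpoly \<Rightarrow> nat \<Rightarrow> ('v mpoly \<times> 'v mpoly \<times> 'v mpoly) set"
  where "Syz x y z d = {(a, b, c). homogeneous d a \<and> homogeneous d b \<and> homogeneous d c \<and>
     a * x + b * y + c * z = 0}"

text \<open>The dimension of \<open>(R/I)\<^sub>k\<close>, the image of \<open>R\<^sub>k\<close> in \<open>R/I\<close>.\<close>

definition hilbert_function :: "'v::finite mpoly set \<Rightarrow> nat \<Rightarrow> nat" where
  "hilbert_function I k = mpoly.quotient_dim (graded_piece k) I"


section \<open>Lengths of chains\<close>

text \<open>The supremum of the lengths \<open>l\<close> of chains \<open>C\<^sub>0 \<subset> C\<^sub>1 \<subset> \<dots> \<subset> C\<^sub>l\<close> of sets satisfying \<open>P\<close>.\<close>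

definition chain_length :: "('a set \<Rightarrow> bool) \<Rightarrow> enat" where
  "chain_length P =
     (SUP l\<in>{l. \<exists>C. (\<forall>i\<le>l. P (C i)) \<and> (\<forall>i<l. C i \<subset> C (Suc i))}. enat l)"


section \<open>Projective space and subschemes\<close>

text \<open>The points of projective space are the classes of nonzero vectors modulo scaling.\<close>

definition proj_class :: "complex ^ 'v \<Rightarrow> (complex ^ 'v) set" where
  "proj_class v = {c *s v | c. c \<noteq> 0}"

definition proj_space :: "(complex ^ 'v) set set" where
  "proj_space = {proj_class v | v. v \<noteq> 0}"

definition proj_zeros :: "'v::finite mpoly set \<Rightarrow> (complex ^ 'v) set set" where
  "proj_zeros F = {p \<in> proj_space. \<forall>f\<in>F. \<forall>v\<in>p. eval_mpoly f v = 0}"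

text \<open>The degree of a finite subscheme: the eventual value of the Hilbert function.\<close>

definition scheme_degree :: "'v::finite mpoly set \<Rightarrow> nat" where
  "scheme_degree I = (THE D. \<forall>\<^sub>F k in sequentially. hilbert_function I k = D)"

text \<open>The local ring of projective space at \<open>p\<close>, inside the field of fractions of the
  homogeneous coordinate ring.\<close>

definition local_ring ::
    "(complex ^ 'v::{finite,linorder}) set \<Rightarrow> 'v::{finite,linorder} mpoly fract ring" where
  "local_ring p = \<lparr>carrier = {Fract f g | f g. \<exists>k. homogeneous k f \<and> homogeneous k g \<and>
       (\<forall>v\<in>p. eval_mpoly g v \<noteq> 0)},
     monoid.mult = (*), one = 1, ring.zero = 0, add = (+)\<rparr>"

definition local_ideal ::
    "'v::{finite,linorder} mpoly set \<Rightarrow> (complex ^ 'v::{finite,linorder}) set \<Rightarrow> 'v mpoly fract set" where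
  "local_ideal I p = {Fract f g | f g. f \<in> I \<and> (\<exists>k. homogeneous k f \<and> homogeneous k g \<and>
       (\<forall>v\<in>p. eval_mpoly g v \<noteq> 0))}"

definition krull_dim :: "('a, 'b) ring_scheme \<Rightarrow> enat" where
  "krull_dim A = chain_length (\<lambda>P. primeideal P A)"

text \<open>The length of the \<open>A\<close>-module \<open>A/J\<close>, whose submodules are the ideals containing \<open>J\<close>.\<close>

definition quotient_length :: "('a, 'b) ring_scheme \<Rightarrow> 'a set \<Rightarrow> enat" where
  "quotient_length A J = chain_length (\<lambda>K. ideal K A \<and> J \<subseteq> K)"

text \<open>The Hilbert--Samuel multiplicity
  \<open>lim dim(A)! \<ell>(A/q\<^sup>k) / k\<^bsup>dim(A)\<^esup>\<close> of an ideal \<open>q\<close> primary to the maximal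
  ideal of a Noetherian local ring \<open>A\<close>; all the lengths and the dimension are then finite.\<close>

definition hs_multiplicity :: "('a, 'b) ring_scheme \<Rightarrow> 'a set \<Rightarrow> real" where
  "hs_multiplicity A q = (let r = the_enat (krull_dim A) in
     lim (\<lambda>k::nat. fact r * real (the_enat (quotient_length A (q [^]\<^bsub>ideals_set A\<^esub> k))) / real k ^ r))"

definition multiplicity_at ::
    "'v::{finite,linorder} mpoly set \<Rightarrow> (complex ^ 'v::{finite,linorder}) set \<Rightarrow> real" where
  "multiplicity_at I p = hs_multiplicity (local_ring p) (local_ideal I p)"


section \<open>Rational parametrizations of surfaces\<close>

definition zariski_closed :: "(complex ^ 'v::finite) set set \<Rightarrow> bool" where
  "zariski_closed Z \<longleftrightarrow> (\<exists>F. (\<forall>f\<in>F. \<exists>k. homogeneous k f) \<and> Z = proj_zeros F)"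

definition zariski_irreducible :: "(complex ^ 'v::finite) set set \<Rightarrow> bool" where
  "zariski_irreducible Z \<longleftrightarrow> zariski_closed Z \<and> Z \<noteq> {} \<and>
     (\<forall>A B. zariski_closed A \<and> zariski_closed B \<and> Z = A \<union> B \<longrightarrow> Z = A \<or> Z = B)"

text \<open>The Krull dimension of a closed set in the Zariski topology (the empty set gets the
  value \<open>0\<close> here).\<close>

definition zariski_dim :: "(complex ^ 'v::finite) set set \<Rightarrow> enat" where
  "zariski_dim Z = chain_length (\<lambda>C. zariski_irreducible C \<and> C \<subseteq> Z)"

text \<open>The image of the rational map \<open>(s:t:u) \<mapsto> (x:y:z:w)\<close>, for forms \<open>x, y, z, w\<close> of the
  same degree; it is undefined at their common zeros.\<close>

definition rational_image ::
    "3 mpoly \<Rightarrow> 3 mpoly \<Rightarrow> 3 mpoly \<Rightarrow> 3 mpoly \<Rightarrow> (complex ^ 4) set set" where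
  "rational_image x y z w = {proj_class q | q v. v \<noteq> 0 \<and> q \<noteq> 0 \<and>
     q = vector [eval_mpoly x v, eval_mpoly y v, eval_mpoly z v, eval_mpoly w v]}"

definition parametrizes_surface :: "3 mpoly \<Rightarrow> 3 mpoly \<Rightarrow> 3 mpoly \<Rightarrow> 3 mpoly \<Rightarrow> bool" where
  "parametrizes_surface x y z w \<longleftrightarrow> zariski_dim (zariski_closed hull rational_image x y z w) = 2"


section \<open>Base point conditions\<close>

definition BP1 :: "nat \<Rightarrow> 3 mpoly \<Rightarrow> 3 mpoly \<Rightarrow> 3 mpoly \<Rightarrow> 3 mpoly \<Rightarrow> bool" where
  "BP1 n x y z w \<longleftrightarrow>
     homogeneous n x \<and> homogeneous n y \<and> homogeneous n z \<and> homogeneous n w \<and>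
     distinct [x, y, z, w] \<and> mpoly.independent {x, y, z, w}"

definition BP2 :: "3 mpoly set \<Rightarrow> bool" where
  "BP2 I \<longleftrightarrow> finite (proj_zeros I) \<and>
     real (scheme_degree I) = (\<Sum>p\<in>proj_zeros I. multiplicity_at I p)"

definition BP3 :: "nat \<Rightarrow> nat \<Rightarrow> 3 mpoly set \<Rightarrow> bool" where
  "BP3 n d I \<longleftrightarrow> hilbert_function I (d + n) = scheme_degree I"

definition BP4 :: "3 mpoly \<Rightarrow> 3 mpoly \<Rightarrow> 3 mpoly \<Rightarrow> 3 mpoly \<Rightarrow> bool" where
  "BP4 x y z w \<longleftrightarrow> w \<in> saturation (ideal_gen {x, y, z})"

definition BP5 :: "nat \<Rightarrow> 3 mpoly \<Rightarrow> 3 mpoly \<Rightarrow> 3 mpoly \<Rightarrow> bool" where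
  "BP5 d x y z \<longleftrightarrow> mpoly3.dim (Syz x y z d) = 0"

end

theory Submission
  imports Defs "HOL-Computational_Algebra.Polynomial"
begin

text \<open>The theorem is a comparison of dimensions. Write \<open>h k\<close> for the dimension of
  \<open>(R/I)\<^sub>k\<close>.

  In degree \<open>n\<close> the ideal \<open>I\<close> is spanned by its four generators, so
  \<open>h n \<ge> (n + 2 choose 2) - 4\<close> (\<open>hilbert_function_generating_degree\<close>).

  Since \<open>I\<close> is saturated, \<open>h\<close> never decreases (\<open>hilbert_function_le_Suc\<close>). The usual reason is
  that some linear form is a nonzerodivisor on \<open>R/I\<close>. Finding one takes associated primes, which
  can be avoided: if \<open>h (k + 1) < h k\<close>, counting unknowns and equations gives a nonzero element
  \<open>f\<close> of \<open>(R/I)\<^sub>k[\<tau>]\<close> that is killed by the linear form \<open>s + t \<tau> + u \<tau>\<^sup>2\<close> on the moment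
  curve. By McCoy's theorem (\<open>McCoy_mod_ideal\<close>) some nonzero constant \<open>c\<close> in \<open>R/I\<close> is then killed
  by each of \<open>s\<close>, \<open>t\<close>, \<open>u\<close>, which contradicts saturation.

  Finally, if \<open>x\<close>, \<open>y\<close>, \<open>z\<close> have no syzygy of degree \<open>d\<close>, the map
  \<open>(a, b, c) \<mapsto> a x + b y + c z\<close> embeds \<open>R\<^sub>d\<^sup>3\<close> into \<open>I\<close> in degree \<open>d + n\<close>,
  so \<open>h (d + n) \<le> (d + n + 2 choose 2) - 3 (d + 2 choose 2)\<close>
  (\<open>hilbert_function_without_syzygies\<close>).

  Together, \<open>(n + 2 choose 2) + 3 (d + 2 choose 2) \<le> (d + n + 2 choose 2) + 4\<close>. For
  \<open>d = n - 2\<close> this says \<open>n \<le> 3\<close>, and for \<open>d = n - 1\<close> it says \<open>n \<le> 1\<close>, whereas four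
  linearly independent forms of degree \<open>n\<close> exist only if \<open>n \<ge> 2\<close>.\<close>

section \<open>Counting dimensions modulo a subspace\<close>

context vector_space
begin

text \<open>This is the single counting principle behind all the estimates: more unknowns than equations.
  It is stated for a family \<open>v\<close> rather than a set because the vectors may repeat, and the proof is
  Gaussian elimination, removing one element \<open>t\<close> of \<open>T\<close> together with one pivot \<open>x0\<close>.\<close>

lemma exists_relation_mod_subspace:
  assumes "subspace W" and "finite T" and "finite X" and "card T < card X"
    and "v ` X \<subseteq> span (T \<union> W)"
  shows "\<exists>a. (\<exists>x\<in>X. a x \<noteq> 0) \<and> (\<Sum>x\<in>X. scale (a x) (v x)) \<in> W"
  using assms(2-5)
proof (induction T arbitrary: X v rule: finite_induct)
  case empty
  then have "X \<noteq> {}" by auto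
  moreover have "(\<Sum>x\<in>X. scale 1 (v x)) \<in> W"
    using empty assms(1) by (intro subspace_sum) (auto simp: span_eq_iff[THEN iffD2])
  ultimately show ?case
    by (intro exI[of _ "\<lambda>_. 1"]) auto
next
  case (insert t T)
  have "\<exists>k. v x - scale k t \<in> span (T \<union> W)" if "x \<in> X" for x
    using insert.prems(3) that by (auto simp: span_breakdown_eq)
  then obtain k where k: "\<And>x. x \<in> X \<Longrightarrow> v x - scale (k x) t \<in> span (T \<union> W)"
    by metis
  show ?case
  proof (cases "\<forall>x\<in>X. k x = 0")
    case True
    with k have "v ` X \<subseteq> span (T \<union> W)" by force
    moreover have "card T < card X" using insert by simp
    ultimately show ?thesis using insert.IH insert.prems(1) by blast
  next
    case False
    then obtain x0 where x0: "x0 \<in> X" "k x0 \<noteq> 0" by auto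
    \<comment> \<open>subtracting multiples of the pivot vector makes the coefficient of \<open>t\<close> vanish\<close>
    define v' where "v' x = v x - scale (k x / k x0) (v x0)" for x
    have v': "v' x \<in> span (T \<union> W)" if "x \<in> X - {x0}" for x
    proof -
      have "v' x = (v x - scale (k x) t) - scale (k x / k x0) (v x0 - scale (k x0) t)"
        using x0 by (simp add: v'_def scale_right_diff_distrib)
      then show ?thesis
        using k that x0 by (metis DiffD1 span_diff span_scale)
    qed
    have "card T < card (X - {x0})"
      using insert x0 by simp
    then have "\<exists>a. (\<exists>x\<in>X - {x0}. a x \<noteq> 0) \<and> (\<Sum>x\<in>X - {x0}. scale (a x) (v' x)) \<in> W"
      using insert.prems(1) v' by (intro insert.IH) auto
    then obtain a
      where a: "\<exists>x\<in>X - {x0}. a x \<noteq> 0" "(\<Sum>x\<in>X - {x0}. scale (a x) (v' x)) \<in> W"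
      by blast
    \<comment> \<open>the coefficient of the pivot collects what was subtracted\<close>
    define b where "b = a(x0 := - (\<Sum>x\<in>X - {x0}. a x * (k x / k x0)))"
    have "(\<Sum>x\<in>X. scale (b x) (v x)) =
        scale (b x0) (v x0) + (\<Sum>x\<in>X - {x0}. scale (b x) (v x))"
      using insert.prems x0 by (simp add: sum.remove)
    also have "(\<Sum>x\<in>X - {x0}. scale (b x) (v x)) = (\<Sum>x\<in>X - {x0}. scale (a x) (v x))"
      by (intro sum.cong) (auto simp: b_def)
    also have "scale (b x0) (v x0) + \<dots> = (\<Sum>x\<in>X - {x0}. scale (a x) (v' x))"
      by (simp add: b_def v'_def scale_right_diff_distrib sum_subtractf scale_sum_left
          del: times_divide_eq_right times_divide_eq_left)
    finally have "(\<Sum>x\<in>X. scale (b x) (v x)) \<in> W"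
      using a by simp
    moreover have "\<exists>x\<in>X. b x \<noteq> 0"
      using a(1) by (auto simp: b_def)
    ultimately show ?thesis by blast
  qed
qed

definition independent_mod :: "'b set \<Rightarrow> 'b set \<Rightarrow> bool" where
  "independent_mod W B \<longleftrightarrow> (\<forall>a. (\<Sum>b\<in>B. scale (a b) b) \<in> W \<longrightarrow> (\<forall>b\<in>B. a b = 0))"

lemma independent_mod_card_le:
  assumes "subspace W" "finite T" "finite B" "local.independent_mod W B" "B \<subseteq> span (T \<union> W)"
  shows "card B \<le> card T"
proof (rule ccontr)
  assume "\<not> card B \<le> card T"
  then obtain a where "\<exists>b\<in>B. a b \<noteq> 0" "(\<Sum>b\<in>B. scale (a b) b) \<in> W"
    using exists_relation_mod_subspace[of W T B "\<lambda>b. b"] assms by (auto simp: not_le)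
  with assms(4) show False
    unfolding local.independent_mod_def by blast
qed

lemma in_span_Un_subspace_iff:
  assumes "subspace W" "finite B"
  shows "v \<in> span (B \<union> W) \<longleftrightarrow> (\<exists>a. v - (\<Sum>b\<in>B. scale (a b) b) \<in> W)"
proof -
  have W: "span W = W" using assms by (simp add: span_eq_iff)
  show ?thesis
  proof
    assume "v \<in> span (B \<union> W)"
    then obtain a w where "w \<in> W" "v = (\<Sum>b\<in>B. scale (a b) b) + w"
      using assms by (auto simp: span_Un W span_finite)
    then show "\<exists>a. v - (\<Sum>b\<in>B. scale (a b) b) \<in> W"
      by (intro exI[of _ a]) simp
  next
    assume "\<exists>a. v - (\<Sum>b\<in>B. scale (a b) b) \<in> W"
    then obtain a where a: "v - (\<Sum>b\<in>B. scale (a b) b) \<in> W" by blast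
    have "(\<Sum>b\<in>B. scale (a b) b) \<in> span (B \<union> W)"
      by (intro span_sum span_scale span_base) auto
    moreover have "v - (\<Sum>b\<in>B. scale (a b) b) \<in> span (B \<union> W)"
      using a by (intro span_base) auto
    ultimately show "v \<in> span (B \<union> W)"
      using span_add by fastforce
  qed
qed

lemma independent_mod_insert:
  assumes "subspace W" "finite B" "local.independent_mod W B" "v \<notin> span (B \<union> W)"
  shows "local.independent_mod W (insert v B)"
  unfolding local.independent_mod_def
proof (intro allI impI)
  fix a assume a: "(\<Sum>b\<in>insert v B. scale (a b) b) \<in> W"
  have "v \<notin> B" using assms(4) span_base by blast
  then have s: "scale (a v) v + (\<Sum>b\<in>B. scale (a b) b) \<in> W"
    using a assms(2) by simp
  have "a v = 0"
  proof (rule ccontr)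
    assume "a v \<noteq> 0"
    then have "scale (1 / a v) (scale (a v) v + (\<Sum>b\<in>B. scale (a b) b)) =
        v - (\<Sum>b\<in>B. scale (- (a b / a v)) b)"
      by (simp add: scale_right_distrib scale_sum_right sum_negf)
    then have "v - (\<Sum>b\<in>B. scale (- (a b / a v)) b) \<in> W"
      using subspace_scale[OF assms(1) s, of "1 / a v"] by simp
    then have "v \<in> span (B \<union> W)"
      unfolding in_span_Un_subspace_iff[OF assms(1,2)] by (rule exI[of _ "\<lambda>b. - (a b / a v)"])
    with assms(4) show False ..
  qed
  with s assms(3) show "\<forall>b\<in>insert v B. a b = 0"
    by (auto simp: local.independent_mod_def)
qed

text \<open>When \<open>V\<close> is finite-dimensional modulo \<open>W\<close>, a basis modulo \<open>W\<close> exists as a largest family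
  in \<open>V\<close> independent modulo \<open>W\<close>, and by the counting above all of them have the same size, so
  that \<open>quotient_dim\<close> has its intended value.\<close>

lemma quotient_basis_exists:
  assumes "subspace W" "finite T" "V \<subseteq> span (T \<union> W)"
  obtains B where "B \<subseteq> V" "finite B" "local.independent_mod W B" "V \<subseteq> span (B \<union> W)"
    "card B = local.quotient_dim V W"
proof -
  define P where "P n \<longleftrightarrow> (\<exists>B. B \<subseteq> V \<and> finite B \<and> local.independent_mod W B \<and> card B = n)" for n
  have "P 0" by (auto simp: P_def local.independent_mod_def)
  moreover have "\<forall>n. P n \<longrightarrow> n \<le> card T"
    using independent_mod_card_le[OF assms(1,2)] assms(3) by (auto simp: P_def)
  ultimately obtain n where "P n" and max: "\<And>m. P m \<Longrightarrow> m \<le> n"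
    using GreatestI_nat[of P 0 "card T"] Greatest_le_nat[of P _ "card T"] by blast
  then obtain B where B: "B \<subseteq> V" "finite B" "local.independent_mod W B" "card B = n"
    by (auto simp: P_def)
  have span: "V \<subseteq> span (B \<union> W)"
  proof
    fix v assume v: "v \<in> V"
    show "v \<in> span (B \<union> W)"
    proof (rule ccontr)
      assume new: "v \<notin> span (B \<union> W)"
      then have "v \<notin> B" using span_base by blast
      moreover have "local.independent_mod W (insert v B)"
        using independent_mod_insert[OF assms(1) B(2,3) new] .
      ultimately have "P (Suc n)"
        using B v by (auto simp: P_def intro!: exI[of _ "insert v B"])
      with max show False by fastforce
    qed
  qed
  have "local.quotient_dim V W = card B"
    unfolding local.quotient_dim_def
  proof (rule the_equality)
    show "\<exists>B'. B' \<subseteq> V \<and> finite B' \<and> card B' = card B \<and>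
      (\<forall>a. (\<Sum>b\<in>B'. scale (a b) b) \<in> W \<longrightarrow> (\<forall>b\<in>B'. a b = 0)) \<and>
      (\<forall>v\<in>V. \<exists>a. v - (\<Sum>b\<in>B'. scale (a b) b) \<in> W)"
      using B span in_span_Un_subspace_iff[OF assms(1) B(2)]
      by (intro exI[of _ B]) (auto simp: local.independent_mod_def)
  next
    fix N
    assume "\<exists>B'. B' \<subseteq> V \<and> finite B' \<and> card B' = N \<and>
      (\<forall>a. (\<Sum>b\<in>B'. scale (a b) b) \<in> W \<longrightarrow> (\<forall>b\<in>B'. a b = 0)) \<and>
      (\<forall>v\<in>V. \<exists>a. v - (\<Sum>b\<in>B'. scale (a b) b) \<in> W)"
    then obtain B' where B': "B' \<subseteq> V" "finite B'" "card B' = N" "local.independent_mod W B'"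
        and "\<forall>v\<in>V. \<exists>a. v - (\<Sum>b\<in>B'. scale (a b) b) \<in> W"
      unfolding local.independent_mod_def by blast
    then have "V \<subseteq> span (B' \<union> W)"
      using in_span_Un_subspace_iff[OF assms(1)] by blast
    with B' have "card B' \<le> card B" "card B \<le> card B'"
      using B span by (auto intro!: independent_mod_card_le[OF assms(1)])
    with B' show "N = card B" by simp
  qed
  with that B span show thesis by simp
qed

end

section \<open>McCoy's theorem\<close>

text \<open>Read modulo \<open>I\<close>, a zero divisor \<open>p\<close> in \<open>(A/I)[\<tau>]\<close> is killed by a nonzero constant. Take
  \<open>f \<noteq> 0\<close> of least degree with \<open>p f = 0\<close>. Going down from the top coefficient of \<open>p\<close>, each
  coefficient \<open>p\<^sub>j\<close> kills the leading coefficient of \<open>f\<close>; so \<open>p\<^sub>j f\<close> has smaller degree and is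
  still killed by \<open>p\<close>, hence is zero. Any nonzero coefficient of \<open>f\<close> is the wanted constant.\<close>

lemma McCoy_mod_ideal:
  fixes I :: "'a::comm_ring_1 set" and p f :: "'a poly"
  assumes I: "module.subspace (*) I"
    and "\<forall>j. coeff (p * f) j \<in> I" and "coeff f i \<notin> I"
  shows "\<exists>c. c \<notin> I \<and> (\<forall>j. c * coeff p j \<in> I)"
proof -
  interpret R: module "(*) :: 'a \<Rightarrow> 'a \<Rightarrow> 'a" by (rule module_times)
  have I': "a * b \<in> I" if "a \<in> I \<or> b \<in> I" for a b
    using that R.subspace_scale[OF I] by (metis mult.commute)
  \<comment> \<open>\<open>r\<close> bounds the degree of \<open>f\<close> modulo \<open>I\<close>\<close>
  have main: "\<exists>c. c \<notin> I \<and> (\<forall>j. c * coeff p j \<in> I)"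
    if "\<forall>l>r. coeff f l \<in> I" "\<exists>i. coeff f i \<notin> I" "\<forall>j. coeff (p * f) j \<in> I" for r f
    using that
  proof (induction r arbitrary: f rule: less_induct)
    case (less r)
    show ?case
    proof (cases "\<exists>r'<r. \<exists>g. (\<forall>l>r'. coeff g l \<in> I) \<and> (\<exists>i. coeff g i \<notin> I) \<and>
        (\<forall>j. coeff (p * g) j \<in> I)")
      case True
      with less.IH show ?thesis by blast
    next
      case minimal: False
      have step: "\<forall>l. coeff p j * coeff f l \<in> I"
        if above: "\<And>i. i > j \<Longrightarrow> \<forall>l. coeff p i * coeff f l \<in> I" for j
      proof (rule ccontr)
        assume neg: "\<not> ?thesis"
        \<comment> \<open>the other terms have a coefficient of \<open>p\<close> above \<open>j\<close> or one of \<open>f\<close> above \<open>r\<close>\<close>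
        have "coeff (p * f) (j + r) - coeff p j * coeff f r =
            (\<Sum>i\<in>{..j + r} - {j}. coeff p i * coeff f (j + r - i))"
          by (simp add: coeff_mult sum.remove[of "{..j + r}" j])
        also have "\<dots> \<in> I"
        proof (rule R.subspace_sum[OF I])
          fix i assume "i \<in> {..j + r} - {j}"
          then have "i > j \<or> j + r - i > r" by auto
          then show "coeff p i * coeff f (j + r - i) \<in> I"
            using above less.prems(1) I' by blast
        qed
        finally have top: "coeff p j * coeff f r \<in> I"
          using less.prems(3) R.subspace_diff[OF I]
          by (metis add_diff_cancel_left' diff_diff_eq2 add.commute diff_add_cancel)
        define g where "g = smult (coeff p j) f"
        have "\<exists>i. coeff g i \<notin> I"
          using neg by (auto simp: g_def)
        moreover have g_top: "\<forall>l\<ge>r. coeff g l \<in> I"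
          using less.prems(1) top I' by (auto simp: g_def le_less)
        ultimately have "r > 0" by (metis gr0I le0)
        with g_top have "\<forall>l>r - 1. coeff g l \<in> I" by auto
        moreover have "\<forall>j. coeff (p * g) j \<in> I"
          using less.prems(3) I' by (simp add: g_def)
        ultimately show False
          using minimal \<open>\<exists>i. coeff g i \<notin> I\<close> \<open>r > 0\<close>
          by (meson diff_less zero_less_one)
      qed
      have "\<forall>l. coeff p j * coeff f l \<in> I" for j
      proof (induction "degree p - j" arbitrary: j rule: less_induct)
        case less
        show ?case
        proof (cases "j > degree p")
          case True
          then show ?thesis using R.subspace_0[OF I] by (simp add: coeff_eq_0)
        next
          case False
          have "\<forall>l. coeff p i * coeff f l \<in> I" if "i > j" for i
          proof (cases "i > degree p")
            case True
            then show ?thesis using R.subspace_0[OF I] by (simp add: coeff_eq_0)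
          next
            case i: False
            with that have "degree p - i < degree p - j" by linarith
            then show ?thesis using less by blast
          qed
          then show ?thesis by (rule step)
        qed
      qed
      then show ?thesis
        using less.prems(2) by (metis mult.commute)
    qed
  qed
  have "\<forall>l>degree f. coeff f l \<in> I"
    using R.subspace_0[OF I] by (simp add: coeff_eq_0)
  with main[of "degree f" f] assms show ?thesis by blast
qed

section \<open>Forms\<close>

definition total_degree :: "('v::finite \<Rightarrow>\<^sub>0 nat) \<Rightarrow> nat" where
  "total_degree m = (\<Sum>i\<in>UNIV. Poly_Mapping.lookup m i)"

lemma homogeneous_iff_total_degree:
  "homogeneous k f \<longleftrightarrow> (\<forall>m. Poly_Mapping.lookup f m \<noteq> 0 \<longrightarrow> total_degree m = k)"
  by (auto simp: homogeneous_def total_degree_def in_keys_iff)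

lemma total_degree_add: "total_degree (m + m') = total_degree m + total_degree m'"
  by (simp add: total_degree_def lookup_add sum.distrib)

lemma lookup_cscale: "Poly_Mapping.lookup (cscale c f) m = c * Poly_Mapping.lookup f m"
proof -
  have "cscale c f = Poly_Mapping.map ((*) c) f"
    unfolding cscale_def by (rule mult_map_scale_conv_mult[symmetric])
  then show ?thesis
    by (simp add: Poly_Mapping.map.rep_eq when_def)
qed

lemma subspace_graded_piece: "mpoly.subspace (graded_piece k :: 'v::finite mpoly set)"
proof (rule mpoly.subspaceI)
  fix f g :: "'v::finite mpoly"
  assume "f \<in> graded_piece k" "g \<in> graded_piece k"
  moreover have "Poly_Mapping.lookup f m \<noteq> 0 \<or> Poly_Mapping.lookup g m \<noteq> 0"
    if "Poly_Mapping.lookup (f + g) m \<noteq> 0" for m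
    using that by (auto simp: lookup_add)
  ultimately show "f + g \<in> graded_piece k"
    unfolding homogeneous_iff_total_degree mem_Collect_eq by blast
qed (simp_all add: homogeneous_iff_total_degree lookup_cscale)

lemma homogeneous_mult:
  assumes "homogeneous j f" "homogeneous k g"
  shows "homogeneous (j + k) (f * g)"
  unfolding homogeneous_iff_total_degree
proof (intro allI impI)
  fix m assume "Poly_Mapping.lookup (f * g) m \<noteq> 0"
  then obtain a b where "m = a + b" "Poly_Mapping.lookup f a \<noteq> 0" "Poly_Mapping.lookup g b \<noteq> 0"
    using keys_mult[of f g] by (auto simp: in_keys_iff)
  with assms show "total_degree m = j + k"
    by (simp add: homogeneous_iff_total_degree total_degree_add)
qed

lemma homogeneous_var: "homogeneous 1 (var i)"
  by (simp add: homogeneous_def var_def lookup_single when_def)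

lemma homogeneous_sum_scaled:
  assumes "\<And>b. b \<in> B \<Longrightarrow> homogeneous k b"
  shows "homogeneous k (\<Sum>b\<in>B. cscale (a b) b)"
proof -
  have "(\<Sum>b\<in>B. cscale (a b) b) \<in> graded_piece k"
    using assms
    by (intro mpoly.subspace_sum[OF subspace_graded_piece]
        mpoly.subspace_scale[OF subspace_graded_piece]) simp
  then show ?thesis by simp
qed

definition monomial :: "('v \<Rightarrow>\<^sub>0 nat) \<Rightarrow> 'v mpoly" where
  "monomial m = Poly_Mapping.single m 1"

definition exponents :: "nat \<Rightarrow> ('v::finite \<Rightarrow>\<^sub>0 nat) set" where
  "exponents k = {m. total_degree m = k}"

lemma lookup_sum_monomials:
  assumes "finite D"
  shows "Poly_Mapping.lookup (\<Sum>m\<in>D. cscale (a m) (monomial m)) q = (if q \<in> D then a q else 0)"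
  using assms by (simp add: lookup_sum lookup_cscale monomial_def lookup_single when_def
      if_distrib[of "(*) _"] cong: if_cong)

lemma homogeneous_sum_monomials:
  assumes "finite D" "D \<subseteq> exponents k"
  shows "homogeneous k (\<Sum>m\<in>D. cscale (a m) (monomial m))"
  using assms by (auto simp: homogeneous_iff_total_degree lookup_sum_monomials exponents_def)

lemma homogeneous_in_span_monomials:
  assumes "homogeneous k f"
  shows "f \<in> mpoly.span (monomial ` exponents k)"
proof -
  have "f = (\<Sum>m\<in>Poly_Mapping.keys f. cscale (Poly_Mapping.lookup f m) (monomial m))"
    by (rule poly_mapping_eqI) (simp add: lookup_sum_monomials in_keys_iff)
  also have "\<dots> \<in> mpoly.span (monomial ` exponents k)"
    using assms
    by (intro mpoly.span_sum mpoly.span_scale mpoly.span_base)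
      (auto simp: exponents_def homogeneous_def total_degree_def)
  finally show ?thesis .
qed

lemma exponents_3:
  "finite (exponents k :: (3 \<Rightarrow>\<^sub>0 nat) set)"
  "card (exponents k :: (3 \<Rightarrow>\<^sub>0 nat) set) = (k + 2) choose 2"
proof -
  let ?L = "{l :: nat list. length l = 3 \<and> sum_list l = k}"
  let ?h = "\<lambda>m :: 3 \<Rightarrow>\<^sub>0 nat. map (Poly_Mapping.lookup m) [1, 2, 3]"
  have "bij_betw ?h (exponents k) ?L"
    unfolding bij_betw_def
  proof
    show "inj_on ?h (exponents k)"
      by (auto intro!: inj_onI poly_mapping_eqI) (metis exhaust_3)
    show "?h ` exponents k = ?L"
    proof (intro subset_antisym subsetI)
      fix l assume "l \<in> ?h ` exponents k"
      then show "l \<in> ?L"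
        by (auto simp: exponents_def total_degree_def sum_3)
    next
      fix l assume l: "l \<in> ?L"
      then obtain a b c where abc: "l = [a, b, c]"
        by (auto simp: numeral_3_eq_3 length_Suc_conv)
      let ?m = "Abs_poly_mapping (\<lambda>i::3. if i = 1 then a else if i = 2 then b else c)"
      have "?h ?m = l" "?m \<in> exponents k"
        using l abc by (simp_all add: exponents_def total_degree_def sum_3)
      then show "l \<in> ?h ` exponents k" by blast
    qed
  qed
  moreover have L: "card ?L = (k + 2) choose 2"
    using card_length_sum_list[of 3 k] binomial_symmetric[of 2 "k + 2"] by simp
  moreover have "finite ?L"
    using L by (intro card_ge_0_finite) simp
  ultimately show "finite (exponents k :: (3 \<Rightarrow>\<^sub>0 nat) set)"
    "card (exponents k :: (3 \<Rightarrow>\<^sub>0 nat) set) = (k + 2) choose 2"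
    by (simp_all add: bij_betw_finite bij_betw_same_card)
qed

section \<open>Hilbert functions\<close>

lemma subspace_of_ideal:
  fixes I :: "'v mpoly set"
  assumes "module.subspace (*) I"
  shows "mpoly.subspace I"
proof -
  interpret R: module "(*) :: 'v mpoly \<Rightarrow> 'v mpoly \<Rightarrow> 'v mpoly" by (rule module_times)
  show ?thesis
    using assms by (simp add: mpoly.subspace_def R.subspace_def cscale_def)
qed

lemma hilbert_function_basis:
  fixes I :: "3 mpoly set"
  assumes "module.subspace (*) I"
  obtains B where "B \<subseteq> graded_piece k" "finite B" "mpoly.independent_mod I B"
    "graded_piece k \<subseteq> mpoly.span (B \<union> I)" "card B = hilbert_function I k"
proof -
  have "graded_piece k \<subseteq> mpoly.span (monomial ` exponents k \<union> I)"
    using homogeneous_in_span_monomials mpoly.span_mono[of "monomial ` exponents k"] by blast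
  with that show thesis
    using mpoly.quotient_basis_exists[OF subspace_of_ideal[OF assms]
        finite_imageI[OF exponents_3(1)]]
    unfolding hilbert_function_def by metis
qed

lemma mem_saturationI:
  fixes I :: "'v mpoly set"
  assumes I: "module.subspace (*) I" and c: "\<And>i. c * var i \<in> I"
  shows "c \<in> saturation I"
proof -
  interpret R: module "(*) :: 'v mpoly \<Rightarrow> 'v mpoly \<Rightarrow> 'v mpoly" by (rule module_times)
  have Q: "R.subspace {g. c * g \<in> I}"
  proof (rule R.subspaceI)
    fix g h assume "h \<in> {g. c * g \<in> I}"
    then show "g * h \<in> {g. c * g \<in> I}"
      using R.subspace_scale[OF I, of "c * h" g] by (metis mem_Collect_eq mult.left_commute)
  qed (use I in \<open>auto simp: R.subspace_def distrib_left\<close>)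
  have "R.span (range var) \<subseteq> {g. c * g \<in> I}"
    using c by (intro R.span_minimal Q) auto
  then have "{prod_list fs |fs. length fs = 1 \<and> set fs \<subseteq> R.span (range var)} \<subseteq> {g. c * g \<in> I}"
    by (auto simp: length_Suc_conv)
  then have "ideal_power (R.span (range var)) 1 \<subseteq> {g. c * g \<in> I}"
    unfolding ideal_power_def by (intro R.span_minimal Q)
  then show ?thesis
    unfolding saturation_def by blast
qed

text \<open>The combinations of the products \<open>b \<tau>\<^sup>i\<close>, with \<open>b\<close> in a basis \<open>B\<close> of \<open>(R/I)\<^sub>k\<close> and
  \<open>i \<le> N\<close>, form a space of dimension \<open>(N + 1) h k\<close>. Multiplication by
  \<open>p = s + t \<tau> + u \<tau>\<^sup>2\<close> maps it to a space of dimension \<open>(N + 3) h (k + 1)\<close>. If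
  \<open>h (k + 1) < h k\<close>, this map has a kernel for large \<open>N\<close>, to which McCoy's theorem
  applies.\<close>

lemma hilbert_function_le_Suc:
  fixes I :: "3 mpoly set"
  assumes I: "module.subspace (*) I" and sat: "I = saturation I"
  shows "hilbert_function I k \<le> hilbert_function I (Suc k)"
proof (rule ccontr)
  interpret P: vector_space "\<lambda>c :: complex. smult (Poly_Mapping.single 0 c :: 3 mpoly)"
    by unfold_locales
      (simp_all add: smult_add_right smult_add_left single_add mult_single)
  obtain B where B: "B \<subseteq> graded_piece k" "finite B" "mpoly.independent_mod I B"
    "card B = hilbert_function I k"
    using hilbert_function_basis[OF I] by metis
  obtain C where C: "finite C" "graded_piece (Suc k) \<subseteq> mpoly.span (C \<union> I)"
    "card C = hilbert_function I (Suc k)"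
    using hilbert_function_basis[OF I] by metis
  assume "\<not> hilbert_function I k \<le> hilbert_function I (Suc k)"
  then have less: "card C < card B"
    using B C by simp
  define p :: "3 mpoly poly" where
    "p = monom (var 1) 0 + monom (var 2) 1 + monom (var 3) 2"
  \<comment> \<open>the least \<open>N\<close> with \<open>(N + 3) q < (N + 1) (q + 1)\<close>, where \<open>q = card C\<close>\<close>
  define N where "N = 2 * card C"
  \<comment> \<open>polynomials in \<open>\<tau>\<close> that vanish modulo \<open>I\<close>\<close>
  define W where "W = {g. \<forall>j. coeff g j \<in> I}"
  define X where "X = B \<times> {..N}"
  define T where "T = (\<lambda>(c, j). monom c j) ` (C \<times> {..N + 2})"
  have sI: "mpoly.subspace I" by (rule subspace_of_ideal[OF I])
  have W: "P.subspace W"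
    using sI by (auto simp: P.subspace_def W_def mpoly.subspace_def cscale_def)
  have "finite T" "finite X"
    using B C by (simp_all add: T_def X_def)
  have "card T \<le> card C * (N + 3)"
    unfolding T_def using C(1) by (intro card_image_le[THEN order_trans])
      (simp_all add: card_cartesian_product algebra_simps)
  also have "\<dots> < Suc (card C) * (N + 1)"
    by (simp add: N_def algebra_simps)
  also have "\<dots> \<le> card B * (N + 1)"
    using less by (intro mult_le_mono1) simp
  also have "\<dots> = card X"
    by (simp add: X_def card_cartesian_product)
  finally have card: "card T < card X" .
  have monom_span: "monom g j \<in> P.span (T \<union> W)" if "homogeneous (Suc k) g" "j \<le> N + 2" for g j
  proof -
    have "g \<in> mpoly.span (C \<union> I)"
      using that(1) C(2) by auto
    then obtain a where a: "g - (\<Sum>c\<in>C. cscale (a c) c) \<in> I"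
      unfolding mpoly.in_span_Un_subspace_iff[OF sI C(1)] by blast
    have "monom g j = monom (g - (\<Sum>c\<in>C. cscale (a c) c)) j +
        (\<Sum>c\<in>C. smult (Poly_Mapping.single 0 (a c)) (monom c j))"
      by (simp add: smult_monom cscale_def monom_sum diff_monom[symmetric])
    also have "\<dots> \<in> P.span (T \<union> W)"
    proof (intro P.span_add P.span_sum P.span_scale P.span_base)
      show "monom (g - (\<Sum>c\<in>C. cscale (a c) c)) j \<in> T \<union> W"
        using a mpoly.subspace_0[OF sI] by (simp add: W_def)
    qed (use that in \<open>force simp: T_def\<close>)
    finally show ?thesis .
  qed
  have v: "p * monom (fst x) (snd x) \<in> P.span (T \<union> W)" if xX: "x \<in> X" for x
  proof -
    obtain b i where x: "x = (b, i)" "homogeneous k b" "i \<le> N"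
      using xX B(1) by (auto simp: X_def)
    have "p * monom b i = monom (var 1 * b) i + monom (var 2 * b) (Suc i) + monom (var 3 * b) (i + 2)"
      by (simp add: p_def distrib_right mult_monom)
    moreover have "homogeneous (Suc k) (var l * b)" for l
      using homogeneous_mult[OF homogeneous_var x(2)] by simp
    ultimately show ?thesis
      using x(1,3) by (simp add: P.span_add monom_span)
  qed
  have "(\<lambda>x. p * monom (fst x) (snd x)) ` X \<subseteq> P.span (T \<union> W)"
    using v by blast
  from P.exists_relation_mod_subspace[OF W \<open>finite T\<close> \<open>finite X\<close> card this]
  obtain a where a: "\<exists>x\<in>X. a x \<noteq> 0"
    "(\<Sum>x\<in>X. smult (Poly_Mapping.single 0 (a x)) (p * monom (fst x) (snd x))) \<in> W"
    by (elim exE conjE)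
  define f where "f = (\<Sum>x\<in>X. smult (Poly_Mapping.single 0 (a x)) (monom (fst x) (snd x)))"
  have "p * f \<in> W"
    using a(2) by (simp add: f_def sum_distrib_left)
  moreover obtain i where "coeff f i \<notin> I"
  proof -
    obtain b0 i where bi: "b0 \<in> B" "i \<le> N" "a (b0, i) \<noteq> 0"
      using a(1) by (auto simp: X_def)
    have "coeff f i = (\<Sum>x\<in>X. if snd x = i then cscale (a x) (fst x) else 0)"
      unfolding f_def coeff_sum by (intro sum.cong) (auto simp: cscale_def)
    also have "\<dots> = (\<Sum>b\<in>B. \<Sum>i'\<le>N. if i' = i then cscale (a (b, i')) b else 0)"
      unfolding X_def sum.cartesian_product by (intro sum.cong) auto
    also have "\<dots> = (\<Sum>b\<in>B. cscale (a (b, i)) b)"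
      using bi by (intro sum.cong) (simp_all add: sum.delta)
    finally have f: "coeff f i = (\<Sum>b\<in>B. cscale (a (b, i)) b)" .
    have "coeff f i \<notin> I"
      using bi B(3)[unfolded mpoly.independent_mod_def, rule_format, of "\<lambda>b. a (b, i)" b0]
      unfolding f by metis
    then show thesis by (rule that)
  qed
  ultimately obtain c where c: "c \<notin> I" "\<And>j. c * coeff p j \<in> I"
    using McCoy_mod_ideal[OF I, of p f i] by (auto simp: W_def)
  have "c * var l \<in> I" for l
    using c(2)[of 0] c(2)[of 1] c(2)[of 2] exhaust_3[of l] by (auto simp: p_def)
  then have "c \<in> saturation I"
    by (rule mem_saturationI[OF I])
  with c(1) sat show False by simp
qed

lemma binomial_le_card_spanning:
  assumes "finite T" "monomial ` (exponents k :: (3 \<Rightarrow>\<^sub>0 nat) set) \<subseteq> mpoly.span T"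
  shows "(k + 2) choose 2 \<le> card T"
proof (rule ccontr)
  assume "\<not> ?thesis"
  then have card: "card T < card (exponents k :: (3 \<Rightarrow>\<^sub>0 nat) set)"
    by (simp add: exponents_3)
  have "monomial ` (exponents k :: (3 \<Rightarrow>\<^sub>0 nat) set) \<subseteq> mpoly.span (T \<union> {0})"
    using assms(2) by simp
  from mpoly.exists_relation_mod_subspace[OF mpoly.subspace_single_0 assms(1) exponents_3(1)
      card this]
  obtain a :: "(3 \<Rightarrow>\<^sub>0 nat) \<Rightarrow> complex" where a: "\<exists>m\<in>exponents k. a m \<noteq> 0"
    "(\<Sum>m\<in>exponents k. cscale (a m) (monomial m)) = 0"
    by auto
  from a(2) have "a m = 0" if "m \<in> exponents k" for m
    using that lookup_sum_monomials[OF exponents_3(1)[of k], of a m] by simp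
  with a(1) show False by blast
qed

text \<open>Only the constant term of \<open>f\<close> contributes to the lowest degree of \<open>f * g\<close>.\<close>

lemma lookup_mult_form:
  assumes "homogeneous k g" "total_degree m = k"
  shows "Poly_Mapping.lookup (f * g) m = Poly_Mapping.lookup f 0 * Poly_Mapping.lookup g m"
proof -
  define h where "h = f - Poly_Mapping.single 0 (Poly_Mapping.lookup f 0)"
  have h0: "Poly_Mapping.lookup h 0 = 0"
    by (simp add: h_def lookup_minus)
  have "Poly_Mapping.lookup (h * g) m = 0"
  proof (rule ccontr)
    assume "Poly_Mapping.lookup (h * g) m \<noteq> 0"
    then obtain a b where ab: "m = a + b" "Poly_Mapping.lookup h a \<noteq> 0" "Poly_Mapping.lookup g b \<noteq> 0"
      using keys_mult[of h g] by (auto simp: in_keys_iff)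
    then have "total_degree a = 0"
      using assms by (auto simp: homogeneous_iff_total_degree total_degree_add)
    then have "a = 0"
      by (intro poly_mapping_eqI) (simp add: total_degree_def)
    with ab h0 show False by simp
  qed
  moreover have "f * g = cscale (Poly_Mapping.lookup f 0) g + h * g"
    by (simp add: h_def cscale_def left_diff_distrib)
  ultimately show ?thesis
    by (simp add: lookup_add lookup_cscale)
qed

text \<open>For forms of one common degree, only the constant terms of the cofactors matter in that
  degree.\<close>

lemma ideal_gen_in_generating_degree:
  fixes f :: "'v::finite mpoly"
  assumes "finite S" "\<And>s. s \<in> S \<Longrightarrow> homogeneous n s" "f \<in> ideal_gen S" "homogeneous n f"
  shows "f \<in> mpoly.span S"
proof -
  interpret R: module "(*) :: 'v mpoly \<Rightarrow> 'v mpoly \<Rightarrow> 'v mpoly" by (rule module_times)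
  obtain u where u: "f = (\<Sum>s\<in>S. u s * s)"
    using assms(1,3) by (auto simp: R.span_finite)
  let ?g = "\<Sum>s\<in>S. cscale (Poly_Mapping.lookup (u s) 0) s"
  have "f = ?g"
  proof (rule poly_mapping_eqI)
    fix m
    have g: "homogeneous n ?g"
      using assms(2) by (rule homogeneous_sum_scaled)
    show "Poly_Mapping.lookup f m = Poly_Mapping.lookup ?g m"
    proof (cases "total_degree m = n")
      case True
      then show ?thesis
        by (simp add: u lookup_sum lookup_cscale lookup_mult_form[OF assms(2)])
    next
      case False
      then have "Poly_Mapping.lookup f m = 0" "Poly_Mapping.lookup ?g m = 0"
        using assms(4) g unfolding homogeneous_iff_total_degree by blast+
      then show ?thesis by simp
    qed
  qed
  also have "\<dots> \<in> mpoly.span S"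
    by (intro mpoly.span_sum mpoly.span_scale mpoly.span_base)
  finally show ?thesis .
qed

lemma ideal_gen_subspace:
  fixes S :: "'a::comm_ring_1 set"
  shows "module.subspace (*) (ideal_gen S)" "S \<subseteq> ideal_gen S"
proof -
  interpret R: module "(*) :: 'a \<Rightarrow> 'a \<Rightarrow> 'a" by (rule module_times)
  show "module.subspace (*) (ideal_gen S)" "S \<subseteq> ideal_gen S"
    using R.span_base by auto
qed

lemma hilbert_function_generating_degree:
  fixes S :: "3 mpoly set"
  assumes "finite S" "\<And>s. s \<in> S \<Longrightarrow> homogeneous n s"
  shows "(n + 2) choose 2 \<le> hilbert_function (ideal_gen S) n + card S"
proof -
  let ?I = "ideal_gen S"
  obtain B where B: "B \<subseteq> graded_piece n" "finite B" "graded_piece n \<subseteq> mpoly.span (B \<union> ?I)"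
    "card B = hilbert_function ?I n"
    using hilbert_function_basis[OF ideal_gen_subspace(1)] by metis
  have "f \<in> mpoly.span (B \<union> S)" if f: "homogeneous n f" for f
  proof -
    have "f \<in> mpoly.span (B \<union> ?I)"
      using f B(3) by auto
    then obtain a where a: "f - (\<Sum>b\<in>B. cscale (a b) b) \<in> ?I"
      unfolding mpoly.in_span_Un_subspace_iff[OF subspace_of_ideal[OF ideal_gen_subspace(1)] B(2)]
      by blast
    have "homogeneous n (\<Sum>b\<in>B. cscale (a b) b)"
      using B(1) by (intro homogeneous_sum_scaled) auto
    with f have "homogeneous n (f - (\<Sum>b\<in>B. cscale (a b) b))"
      using mpoly.subspace_diff[OF subspace_graded_piece] by auto
    with a assms have "f - (\<Sum>b\<in>B. cscale (a b) b) \<in> mpoly.span S"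
      by (intro ideal_gen_in_generating_degree)
    then have "f - (\<Sum>b\<in>B. cscale (a b) b) \<in> mpoly.span (B \<union> S)"
      using mpoly.span_mono[of S "B \<union> S"] by blast
    moreover have "(\<Sum>b\<in>B. cscale (a b) b) \<in> mpoly.span (B \<union> S)"
      by (intro mpoly.span_sum mpoly.span_scale mpoly.span_base) auto
    ultimately show ?thesis
      using mpoly.span_add by fastforce
  qed
  moreover have "homogeneous n (monomial m)" if "m \<in> exponents n" for m :: "3 \<Rightarrow>\<^sub>0 nat"
    using that by (simp add: homogeneous_def monomial_def exponents_def total_degree_def lookup_single)
  ultimately have "(n + 2) choose 2 \<le> card (B \<union> S)"
    using B(2) assms(1) by (intro binomial_le_card_spanning) auto
  also have "\<dots> \<le> hilbert_function ?I n + card S"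
    using card_Un_le[of B S] B(4) by simp
  finally show ?thesis .
qed

section \<open>Syzygies\<close>

text \<open>\<open>mpoly3.dim\<close> is also \<open>0\<close> for spaces of infinite dimension, so what has to be shown is
  that the syzygies of a given degree lie in the span of the finite set \<open>G\<close>.\<close>

lemma Syz_trivial_of_dim_0:
  fixes x y z :: "3 mpoly"
  assumes dim: "mpoly3.dim (Syz x y z d) = 0" and v: "v \<in> Syz x y z d"
  shows "v = 0"
proof (rule ccontr)
  assume "v \<noteq> 0"
  then have "mpoly3.independent {v}"
    by simp
  then obtain B where B: "{v} \<subseteq> B" "B \<subseteq> Syz x y z d" "mpoly3.independent B"
      "Syz x y z d \<subseteq> mpoly3.span B"
    using mpoly3.maximal_independent_subset_extend[of "{v}" "Syz x y z d"] v by auto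
  define M where "M = (monomial ` exponents d :: 3 mpoly set)"
  define G where "G = (\<lambda>m. (m, 0, 0)) ` M \<union> (\<lambda>m. (0, m, 0)) ` M \<union> (\<lambda>m. (0, 0, m)) ` M"
  have "finite G"
    by (simp add: G_def M_def exponents_3)
  have "mpoly.span M \<subseteq> {a. (a, 0, 0) \<in> mpoly3.span G \<and> (0, a, 0) \<in> mpoly3.span G \<and>
      (0, 0, a) \<in> mpoly3.span G}"
  proof (rule mpoly.span_minimal)
    show "M \<subseteq> {a. (a, 0, 0) \<in> mpoly3.span G \<and> (0, a, 0) \<in> mpoly3.span G \<and>
        (0, 0, a) \<in> mpoly3.span G}"
      by (auto simp: G_def intro!: mpoly3.span_base)
  next
    have add: "(a + b, 0 :: 3 mpoly, 0 :: 3 mpoly) = (a, 0, 0) + (b, 0, 0)"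
      "(0 :: 3 mpoly, a + b, 0 :: 3 mpoly) = (0, a, 0) + (0, b, 0)"
      "(0 :: 3 mpoly, 0 :: 3 mpoly, a + b) = (0, 0, a) + (0, 0, b)" for a b :: "3 mpoly"
      by simp_all
    have scale: "(cscale k a, 0, 0) = cscale3 k (a, 0, 0)" "(0, cscale k a, 0) = cscale3 k (0, a, 0)"
      "(0, 0, cscale k a) = cscale3 k (0, 0, a)" for k and a :: "3 mpoly"
      by (simp_all add: cscale3_def)
    show "mpoly.subspace {a. (a, 0, 0) \<in> mpoly3.span G \<and> (0, a, 0) \<in> mpoly3.span G \<and>
        (0, 0, a) \<in> mpoly3.span G}"
      unfolding mpoly.subspace_def mem_Collect_eq add scale
      using mpoly3.span_zero[of G] mpoly3.span_add[of _ G] mpoly3.span_scale[of _ G]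
      by (simp add: zero_prod_def del: add_Pair)
  qed
  then have emb: "(a, 0, 0) \<in> mpoly3.span G \<and> (0, a, 0) \<in> mpoly3.span G \<and>
      (0, 0, a) \<in> mpoly3.span G" if "homogeneous d a" for a
    using homogeneous_in_span_monomials[OF that] unfolding M_def by auto
  have "Syz x y z d \<subseteq> mpoly3.span G"
  proof
    fix t assume "t \<in> Syz x y z d"
    then obtain a b c where t: "t = (a, b, c)" "homogeneous d a" "homogeneous d b" "homogeneous d c"
      by (auto simp: Syz_def)
    have "(a, 0, 0) + (0, b, 0) + (0, 0, c) \<in> mpoly3.span G"
      using emb[OF t(2)] emb[OF t(3)] emb[OF t(4)] by (intro mpoly3.span_add) auto
    then show "t \<in> mpoly3.span G"
      by (simp add: t(1))
  qed
  then have "finite B"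
    using mpoly3.independent_span_bound[OF \<open>finite G\<close> B(3)] B(2) by blast
  moreover have "card B = 0"
    using mpoly3.basis_card_eq_dim[OF B(2,4,3)] dim by simp
  ultimately show False
    using B(1) by simp
qed

text \<open>A basis \<open>B\<close> of \<open>R\<close> modulo \<open>I\<close> in degree \<open>d + n\<close> and the products of \<open>x\<close>, \<open>y\<close>, \<open>z\<close> with the
  monomials of degree \<open>d\<close> are linearly independent together: the part on \<open>B\<close> of a linear relation
  lies in \<open>I\<close> and so vanishes, and what remains is a syzygy.\<close>

lemma hilbert_function_without_syzygies:
  fixes I :: "3 mpoly set"
  assumes I: "module.subspace (*) I" and xyz: "x \<in> I" "y \<in> I" "z \<in> I" "distinct [x, y, z]"
    and hom: "homogeneous n x" "homogeneous n y" "homogeneous n z"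
    and syz: "mpoly3.dim (Syz x y z d) = 0"
  shows "hilbert_function I (d + n) + 3 * ((d + 2) choose 2) \<le> (d + n + 2) choose 2"
proof (rule ccontr)
  assume neg: "\<not> ?thesis"
  obtain B where B: "B \<subseteq> graded_piece (d + n)" "finite B" "mpoly.independent_mod I B"
    "card B = hilbert_function I (d + n)"
    using hilbert_function_basis[OF I] by metis
  define X where "X = Sum_Type.Plus B ((exponents d :: (3 \<Rightarrow>\<^sub>0 nat) set) \<times> {x, y, z})"
  define v where "v = case_sum (\<lambda>b. b) (\<lambda>(m, e). monomial m * e :: 3 mpoly)"
  define T where "T = (monomial ` exponents (d + n) :: 3 mpoly set)"
  have "finite T" "finite X"
    using B(2) by (simp_all add: T_def X_def exponents_3)
  have "card T \<le> (d + n + 2) choose 2"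
    unfolding T_def by (rule card_image_le[THEN order_trans]) (simp_all add: exponents_3)
  also have "\<dots> < card X"
    using neg B xyz(4) by (simp add: X_def card_Plus exponents_3 card_cartesian_product)
  finally have card: "card T < card X" .
  have mono: "homogeneous d (monomial m)" if "m \<in> exponents d" for m :: "3 \<Rightarrow>\<^sub>0 nat"
    using that by (simp add: homogeneous_def monomial_def exponents_def total_degree_def lookup_single)
  have "homogeneous (d + n) (v i)" if "i \<in> X" for i
    using that B(1) hom mono by (auto simp: X_def v_def intro!: homogeneous_mult)
  then have "v ` X \<subseteq> mpoly.span (T \<union> {0})"
    using homogeneous_in_span_monomials by (auto simp: T_def)
  from mpoly.exists_relation_mod_subspace[OF mpoly.subspace_single_0 \<open>finite T\<close> \<open>finite X\<close> card this]
  obtain a where a: "\<exists>i\<in>X. a i \<noteq> 0" "(\<Sum>i\<in>X. cscale (a i) (v i)) = 0"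
    by auto
  define h where "h e = (\<Sum>m\<in>exponents d. cscale (a (Inr (m, e))) (monomial m))" for e
  have "(\<Sum>i\<in>exponents d \<times> {x, y, z}. cscale (a (Inr i)) (v (Inr i))) =
      (\<Sum>m\<in>exponents d. \<Sum>e\<in>{x, y, z}. cscale (a (Inr (m, e))) (monomial m * e))"
    by (simp only: sum.cartesian_product' v_def sum.case prod.case)
  also have "\<dots> = (\<Sum>e\<in>{x, y, z}. \<Sum>m\<in>exponents d. cscale (a (Inr (m, e))) (monomial m * e))"
    by (rule sum.swap)
  also have "\<dots> = (\<Sum>e\<in>{x, y, z}. h e * e)"
    by (simp only: h_def sum_distrib_right cscale_def mult.assoc)
  also have "\<dots> = h x * x + h y * y + h z * z"
    using xyz(4) by simp
  finally have rel: "(\<Sum>b\<in>B. cscale (a (Inl b)) b) + (h x * x + h y * y + h z * z) = 0"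
    using a(2) B(2) by (simp add: X_def sum.Plus exponents_3 v_def)
  interpret R: module "(*) :: 3 mpoly \<Rightarrow> 3 mpoly \<Rightarrow> 3 mpoly" by (rule module_times)
  have "h x * x + h y * y + h z * z \<in> I"
    using I xyz by (intro R.subspace_add R.subspace_scale)
  then have "- (h x * x + h y * y + h z * z) \<in> I"
    using R.subspace_neg[OF I] by blast
  moreover have "(\<Sum>b\<in>B. cscale (a (Inl b)) b) = - (h x * x + h y * y + h z * z)"
    using rel by (simp only: eq_neg_iff_add_eq_0)
  ultimately have "(\<Sum>b\<in>B. cscale (a (Inl b)) b) \<in> I"
    by (simp only:)
  then have Inl: "\<forall>b\<in>B. a (Inl b) = 0"
    using B(3)[unfolded mpoly.independent_mod_def, rule_format, of "\<lambda>b. a (Inl b)"] by blast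
  then have "h x * x + h y * y + h z * z = 0"
    using rel by simp
  moreover have "homogeneous d (h e)" for e
    unfolding h_def by (intro homogeneous_sum_monomials exponents_3 order_refl)
  ultimately have "(h x, h y, h z) \<in> Syz x y z d"
    by (simp add: Syz_def)
  then have "h e = 0" if "e \<in> {x, y, z}" for e
    using Syz_trivial_of_dim_0[OF syz] that by (auto simp: zero_prod_def)
  then have "a (Inr (m, e)) = 0" if "m \<in> exponents d" "e \<in> {x, y, z}" for m e
    using that lookup_sum_monomials[OF exponents_3(1)[of d], of "\<lambda>m. a (Inr (m, e))" m]
    by (simp add: h_def)
  with Inl a(1) show False
    by (auto simp: X_def)
qed

section \<open>The saturated case\<close>

theorem proposition4p1:
  fixes n d :: nat and x y z w :: "3 mpoly" and I :: "3 mpoly set"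
  assumes "homogeneous n x" "homogeneous n y" "homogeneous n z" "homogeneous n w"
    and "parametrizes_surface x y z w"
    and "I = ideal_gen {x, y, z, w}"
    and "I = saturation I"
    and "int d \<in> {int n - 2, int n - 1}"
    and "BP1 n x y z w"
    and "BP2 I"
    and "BP3 n d I"
    and "BP4 x y z w"
    and "BP5 d x y z"
  shows "int d = int n - 2 \<and> n \<le> 3"
proof -
  have ideal: "module.subspace (*) I" and gen: "{x, y, z, w} \<subseteq> I"
    unfolding assms(6) by (rule ideal_gen_subspace)+
  have dist: "distinct [x, y, z, w]" and ind: "mpoly.independent {x, y, z, w}"
    using assms(9) by (auto simp: BP1_def)
  then have card4: "card {x, y, z, w} = 4" by simp
  have "(n + 2) choose 2 \<le> hilbert_function I n + 4"
    using hilbert_function_generating_degree[of "{x, y, z, w}" n] assms(1-4,6) card4 by auto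
  also have "hilbert_function I n \<le> hilbert_function I (d + n)"
    using lift_Suc_mono_le[of "hilbert_function I" n "d + n"]
      hilbert_function_le_Suc[OF ideal assms(7)] by simp
  finally have "((n + 2) choose 2) + 3 * ((d + 2) choose 2) \<le> ((d + n + 2) choose 2) + 4"
    using hilbert_function_without_syzygies[OF ideal, of x y z n d] gen dist assms(1-3,13)
    by (simp add: BP5_def)
  moreover have choose: "2 * ((k + 2) choose 2) = (k + 2) * (k + 1)" for k :: nat
    by (simp add: choose_two)
  ultimately have ineq: "(n + 2) * (n + 1) + 3 * ((d + 2) * (d + 1)) \<le> (d + n + 2) * (d + n + 1) + 8"
    using choose[of n] choose[of d] choose[of "d + n"] by linarith
  have "card {x, y, z, w} \<le> card (monomial ` exponents n :: 3 mpoly set)"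
    using mpoly.independent_span_bound[OF finite_imageI[OF exponents_3(1)] ind]
      homogeneous_in_span_monomials assms(1-4) by blast
  also have "\<dots> \<le> (n + 2) choose 2"
    using card_image_le[OF exponents_3(1), of monomial n] by (simp add: exponents_3)
  finally have "8 \<le> (n + 2) * (n + 1)"
    using card4 choose[of n] by linarith
  then have "2 \<le> n"
    by (cases n; cases "n - 1") auto
  consider "n = d + 2" | "n = d + 1"
    using assms(8) by force
  then show ?thesis
  proof cases
    case 1
    then have "n \<le> 3" using ineq by (simp add: algebra_simps)
    with 1 show ?thesis by simp
  next
    case 2
    then have "n \<le> 1" using ineq by (simp add: algebra_simps)
    with \<open>2 \<le> n\<close> show ?thesis by simp
  qed
qed

end
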